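(* The functions $\mathcal{E}:\mathbb{R}^{n\times d}\to\mathbb{R}_+$ and $\mathcal{E}_p:\mathbb{R}^{n\times d}\to\mathbb{R}_+$ (for any fixed $\theta_1,\dots,\theta_p\in\mathbb{S}^{d-1}$) are locally Lipschitz.
   Context: Let $n,d,p\ge1$. A matrix $Y\in\mathbb{R}^{n\times d}$ is written $Y=(y_1,\dots,y_n)^T$ with rows $y_k\in\mathbb{R}^d$, and $\gamma_Y:=\frac1n\sum_{k=1}^n\delta_{y_k}$. Fix $Z\in\mathbb{R}^{n\times d}$. With $\sigma$ the uniform probability measure on the unit sphere $\mathbb{S}^{d-1}$, $P_\theta(x)=\theta^Tx$, $\#$ the push-forward and $\mathrm{W}_2$ the 2-Wasserstein distance, set $w_\theta(Y):=\mathrm{W}_2^2(P_\theta\#\gamma_Y,P_\theta\#\gamma_Z)$, $\mathcal{E}(Y):=\int_{\mathbb{S}^{d-1}}w_\theta(Y)\,d\sigma(\theta)$ and $\mathcal{E}_p(Y):=\frac1p\sum_{i=1}^pw_{\theta_i}(Y)$. Locally Lipschitz means Lipschitz in a neighbourhood of each point. *)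

theory Defs
  imports "HOL-Probability.Probability"
begin

definition locally_lipschitz :: "('a::metric_space \<Rightarrow> 'b::metric_space) \<Rightarrow> bool" where
  "locally_lipschitz f \<longleftrightarrow> (\<forall>x. \<exists>U L. open U \<and> x \<in> U \<and> L-lipschitz_on U f)"

lemma locally_lipschitz_iff_local_lipschitz:
  "locally_lipschitz f \<longleftrightarrow> local_lipschitz {0::real} UNIV (\<lambda>_. f)"
proof
  assume f: "locally_lipschitz f"
  show "local_lipschitz {0::real} UNIV (\<lambda>_. f)"
    unfolding local_lipschitz_def
  proof (intro ballI)
    fix x t
    obtain U L where U: "open U" "x \<in> U" "L-lipschitz_on U f"
      using f unfolding locally_lipschitz_def by blast
    then obtain u where "u > 0" "cball x u \<subseteq> U"
      by (auto simp: open_contains_cball)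
    then show "\<exists>u>0. \<exists>L. \<forall>t\<in>cball t u \<inter> {0::real}. L-lipschitz_on (cball x u \<inter> UNIV) f"
      using lipschitz_on_subset[OF U(3)] by auto
  qed
next
  assume f: "local_lipschitz {0::real} UNIV (\<lambda>_. f)"
  show "locally_lipschitz f"
    unfolding locally_lipschitz_def
  proof
    fix x
    obtain u L where u: "u > 0" "L-lipschitz_on (cball x u) f"
      using f by (force simp: local_lipschitz_def)
    then have "open (ball x u) \<and> x \<in> ball x u \<and> L-lipschitz_on (ball x u) f"
      using lipschitz_on_subset[OF u(2) ball_subset_cball] by simp
    then show "\<exists>U L. open U \<and> x \<in> U \<and> L-lipschitz_on U f"
      by blast
  qed
qed

definition couplings :: "'a measure \<Rightarrow> 'b measure \<Rightarrow> ('a \<times> 'b) measure set" where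
  "couplings \<mu> \<nu> =
     {\<pi>. sets \<pi> = sets (\<mu> \<Otimes>\<^sub>M \<nu>) \<and> distr \<pi> \<mu> fst = \<mu> \<and> distr \<pi> \<nu> snd = \<nu>}"

(* The infimum is taken in the extended nonnegative reals and is finite whenever both
   arguments are probability measures with finite second moment, in particular for
   finitely supported ones; enn2real only affects measures outside that class. *)
definition wasserstein2 :: "'a::metric_space measure \<Rightarrow> 'a measure \<Rightarrow> real" where
  "wasserstein2 \<mu> \<nu> =
     sqrt (enn2real (INF \<pi>\<in>couplings \<mu> \<nu>. \<integral>\<^sup>+z. ennreal ((dist (fst z) (snd z))\<^sup>2) \<partial>\<pi>))"

(* A matrix with n = CARD('n) rows in R^d, d = CARD('d), is an element Y of real^'d^'n;
   its k-th row is Y $ k and its norm is the Frobenius norm. *)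
definition empirical :: "real^'d^'n \<Rightarrow> (real^'d) measure" where
  "empirical Y = measure_of UNIV (sets borel)
     (\<lambda>A. ennreal (1 / real CARD('n)) * (\<Sum>k\<in>UNIV. emeasure (return borel (Y $ k)) A))"

lemma space_empirical [simp]: "space (empirical Y) = UNIV"
  by (simp add: empirical_def space_measure_of_conv)

lemma sets_empirical [simp, measurable_cong]: "sets (empirical Y) = sets borel"
  unfolding empirical_def by (metis sets.sets_measure_of_eq space_borel)

lemma emeasure_empirical:
  fixes Y :: "real^'d^'n"
  assumes "A \<in> sets borel"
  shows "emeasure (empirical Y) A =
    ennreal (1 / real CARD('n)) * (\<Sum>k\<in>UNIV. emeasure (return borel (Y $ k)) A)"
  unfolding empirical_def
proof (rule emeasure_measure_of_sigma)
  show "sigma_algebra UNIV (sets (borel :: (real^'d) measure))"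
    by (metis sets.sigma_algebra_axioms space_borel)
  show "countably_additive (sets borel)
    (\<lambda>A. ennreal (1 / real CARD('n)) * (\<Sum>k\<in>UNIV. emeasure (return borel (Y $ k)) A))"
  proof (rule countably_additiveI)
    fix F :: "nat \<Rightarrow> (real^'d) set"
    assume F: "range F \<subseteq> sets borel" "disjoint_family F"
    have "(\<Sum>i. emeasure (return borel (Y $ k)) (F i)) = emeasure (return borel (Y $ k)) (\<Union>i. F i)"
      for k
      using F by (intro suminf_emeasure) auto
    then show "(\<Sum>i. ennreal (1 / real CARD('n)) * (\<Sum>k\<in>UNIV. emeasure (return borel (Y $ k)) (F i)))
      = ennreal (1 / real CARD('n)) * (\<Sum>k\<in>UNIV. emeasure (return borel (Y $ k)) (\<Union>i. F i))"
      by (simp add: suminf_sum)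
  qed
qed (use assms in \<open>auto simp: positive_def\<close>)

lemma prob_space_empirical: "prob_space (empirical (Y :: real^'d^'n))"
proof (rule prob_spaceI)
  have "ennreal (1 / real CARD('n)) * of_nat CARD('n) = 1"
    by (simp add: ennreal_of_nat_eq_real_of_nat flip: ennreal_mult)
  then show "emeasure (empirical Y) (space (empirical Y)) = 1"
    by (simp add: emeasure_empirical)
qed

(* Cone construction: sgn x = x / norm x radially projects normalised Lebesgue measure on
   the unit ball onto the sphere.  The result is a Borel measure on the whole space,
   concentrated on the sphere (the origin, where sgn is 0, is a null set). *)
definition sphere_unif :: "'a::euclidean_space measure" where
  "sphere_unif = distr (uniform_measure lborel (ball 0 1)) borel sgn"

lemma sets_sphere_unif [simp, measurable_cong]: "sets sphere_unif = sets borel"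
  by (simp add: sphere_unif_def)

lemma measurable_sgn_ball: "sgn \<in> uniform_measure lborel (ball (0::'a::euclidean_space) 1) \<rightarrow>\<^sub>M borel"
  unfolding sgn_div_norm by measurable

lemma prob_space_uniform_ball:
  "prob_space (uniform_measure lborel (ball (0::'a::euclidean_space) 1))"
proof (rule prob_space_uniform_measure)
  show "emeasure lborel (ball (0::'a) 1) \<noteq> 0"
    using content_ball_pos[of 1 "0::'a"] by (auto simp: measure_def)
  show "emeasure lborel (ball (0::'a) 1) \<noteq> \<infinity>"
    using emeasure_lborel_ball_finite[of "0::'a" 1] by auto
qed

lemma prob_space_sphere_unif: "prob_space (sphere_unif :: 'a::euclidean_space measure)"
  unfolding sphere_unif_def
  by (intro prob_space.prob_space_distr prob_space_uniform_ball measurable_sgn_ball)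

lemma AE_sphere_unif: "AE \<theta> in sphere_unif. \<theta> \<in> sphere (0::'a::euclidean_space) 1"
proof -
  have "AE x in lborel. x \<in> ball (0::'a) 1 \<longrightarrow> sgn x \<in> sphere (0::'a) 1"
    using AE_lborel_singleton[of "0::'a"] by eventually_elim (simp add: norm_sgn)
  then have "AE x in uniform_measure lborel (ball (0::'a) 1). sgn x \<in> sphere (0::'a) 1"
    by (intro AE_uniform_measureI) auto
  moreover have "{\<theta> \<in> space borel. \<theta> \<in> sphere (0::'a) 1} \<in> sets borel"
    by simp
  ultimately show ?thesis
    unfolding sphere_unif_def by (subst AE_distr_iff[OF measurable_sgn_ball])
qed

(* The wellorder constraint is inherited from measure_orthogonal_image; it is not needed
   by any definition. *)
lemma uniform_ball_orthogonal_invariant: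
  fixes f :: "real^'d::{finite,wellorder} \<Rightarrow> real^'d::{finite,wellorder}"
  assumes f: "orthogonal_transformation f"
  shows "distr (uniform_measure lborel (ball 0 1)) borel f = uniform_measure lborel (ball 0 1)"
proof (rule measure_eqI)
  fix A assume "A \<in> sets (distr (uniform_measure lborel (ball 0 1)) borel f)"
  then have A: "A \<in> sets borel" by simp
  have fm: "f \<in> borel_measurable borel"
    using f by (intro borel_measurable_continuous_onI linear_continuous_on)
      (simp add: orthogonal_transformation_linear linear_linear)
  have fA: "f -` A \<in> sets borel"
    using measurable_sets[OF fm A] by simp
  define S where "S = ball 0 1 \<inter> f -` A"
  have S: "S \<in> sets borel"
    using fA by (simp add: S_def)
  have fS: "f ` S = ball 0 1 \<inter> A"
  proof -
    have "f ` S = f ` ball 0 1 \<inter> A"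
      by (auto simp: S_def)
    also have "f ` ball 0 1 = ball 0 1"
      using image_orthogonal_transformation_ball[OF f, of 0 1] f
      by (simp add: orthogonal_transformation_linear linear_0)
    finally show ?thesis .
  qed
  have Sm: "S \<in> lmeasurable"
    using S by (intro bounded_set_imp_lmeasurable) (auto simp: S_def bounded_Int)
  have "measure lborel (ball 0 1 \<inter> A) = measure lborel S"
    using measure_orthogonal_image[OF f Sm] fS S A by simp
  moreover have "emeasure lborel (ball 0 1 \<inter> A) < \<infinity>" "emeasure lborel S < \<infinity>"
    using emeasure_bounded_finite[of "ball 0 1 \<inter> A"] emeasure_bounded_finite[of S]
    by (auto simp: S_def bounded_Int)
  ultimately have "emeasure lborel (ball 0 1 \<inter> A) = emeasure lborel S"
    by (metis emeasure_eq_ennreal_measure infinity_ennreal_def less_irrefl)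
  moreover have "emeasure (distr (uniform_measure lborel (ball 0 1)) borel f) A
      = emeasure (uniform_measure lborel (ball 0 1)) (f -` A)"
    using fm A by (subst emeasure_distr) auto
  ultimately show "emeasure (distr (uniform_measure lborel (ball 0 1)) borel f) A
      = emeasure (uniform_measure lborel (ball 0 1)) A"
    using A fA by (simp add: S_def)
qed simp

lemma sphere_unif_orthogonal_invariant:
  fixes f :: "real^'d::{finite,wellorder} \<Rightarrow> real^'d::{finite,wellorder}"
  assumes f: "orthogonal_transformation f"
  shows "distr sphere_unif borel f = sphere_unif"
proof -
  let ?U = "uniform_measure lborel (ball (0 :: real^'d::{finite,wellorder}) 1)"
  have fm: "f \<in> borel_measurable borel"
    using f by (intro borel_measurable_continuous_onI linear_continuous_on)
      (simp add: orthogonal_transformation_linear linear_linear)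
  have sgn_m: "sgn \<in> borel \<rightarrow>\<^sub>M (borel :: (real^'d::{finite,wellorder}) measure)"
    unfolding sgn_div_norm by measurable
  have "f (sgn x) = sgn (f x)" for x
    using f by (simp add: sgn_div_norm linear_scale orthogonal_transformation_linear
        orthogonal_transformation_norm)
  then have "f \<circ> sgn = sgn \<circ> f"
    by (simp add: fun_eq_iff)
  then have "distr sphere_unif borel f = distr ?U borel (sgn \<circ> f)"
    unfolding sphere_unif_def using fm measurable_sgn_ball by (subst distr_distr) auto
  also have "\<dots> = distr (distr ?U borel f) borel sgn"
    using fm sgn_m by (subst distr_distr) auto
  also have "\<dots> = sphere_unif"
    by (simp add: uniform_ball_orthogonal_invariant[OF f] sphere_unif_def)
  finally show ?thesis .
qed

definition sw_slice :: "real^'d^'n \<Rightarrow> real^'d \<Rightarrow> real^'d^'n \<Rightarrow> real" where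
  "sw_slice Z \<theta> Y =
     (wasserstein2 (distr (empirical Y) borel (\<lambda>x. \<theta> \<bullet> x))
                   (distr (empirical Z) borel (\<lambda>x. \<theta> \<bullet> x)))\<^sup>2"

definition sw_energy :: "real^'d^'n \<Rightarrow> real^'d^'n \<Rightarrow> real" where
  "sw_energy Z Y = (LINT \<theta>:sphere 0 1|sphere_unif. sw_slice Z \<theta> Y)"

definition sw_energy_mc :: "real^'d^'n \<Rightarrow> nat \<Rightarrow> (nat \<Rightarrow> real^'d) \<Rightarrow> real^'d^'n \<Rightarrow> real" where
  "sw_energy_mc Z p \<theta> Y = 1 / real p * (\<Sum>i = 1..p. sw_slice Z (\<theta> i) Y)"

lemma sw_slice_nonneg: "0 \<le> sw_slice Z \<theta> Y"
  by (simp add: sw_slice_def)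

lemma sw_energy_nonneg: "0 \<le> sw_energy Z Y"
  unfolding sw_energy_def set_lebesgue_integral_def
  by (intro Bochner_Integration.integral_nonneg) (simp add: sw_slice_nonneg)

lemma sw_energy_mc_nonneg: "0 \<le> sw_energy_mc Z p \<theta> Y"
  by (simp add: sw_energy_mc_def sw_slice_nonneg sum_nonneg)

end

theory Submission
  imports Defs
begin

text \<open>Each slice compares two uniform laws on \<open>n\<close> points of the line. Couplings of such laws lift
  to couplings of the uniform law on the indices with itself, a set which depends neither on the
  points nor on \<open>\<theta>\<close>. Hence \<open>w\<^sub>\<theta>(Y)\<close> is an infimum, over a fixed set of probability weights, of
  averages of the costs \<open>(\<theta> \<bullet> (y\<^sub>i - z\<^sub>j))\<^sup>2\<close>, and it moves by at most the largest change of these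
  costs. This gives the Lipschitz bound in \<open>Y\<close>, uniformly in \<open>\<theta>\<close>, and the continuity in \<open>\<theta>\<close> that
  makes the integral over the sphere well defined.\<close>

section \<open>Lifting couplings of point clouds to couplings of indices\<close>

text \<open>Up to the factor n, these weights are the doubly stochastic matrices.\<close>

definition index_couplings :: "('n \<times> 'n) pmf set" where
  "index_couplings = {q. map_pmf fst q = pmf_of_set UNIV \<and> map_pmf snd q = pmf_of_set UNIV}"

lemma emeasure_distr_pmf_borel:
  fixes h :: "'c \<Rightarrow> 'z::topological_space"
  assumes "A \<in> sets borel"
  shows "emeasure (distr (measure_pmf q) borel h) A = emeasure (measure_pmf q) (h -` A)"
  using assms by (subst emeasure_distr) auto

lemma emeasure_measure_pmf_finite_type:
  fixes q :: "'c::finite pmf"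
  shows "emeasure (measure_pmf q) A = ennreal (\<Sum>x\<in>A. pmf q x)"
  by (simp add: measure_pmf.emeasure_eq_measure measure_measure_pmf_finite)

text \<open>The second conclusion selects one lift among many: when \<open>h\<close> repeats a
  value, mass may be moved freely inside a fibre, and an arbitrary lift would leave the marginals of
  \<open>q\<close> undetermined.\<close>

lemma pmf_lift_finite_support:
  fixes h :: "'c::finite \<Rightarrow> 'z::t1_space"
  assumes "prob_space \<pi>" and sets: "sets \<pi> = sets borel"
    and supp: "AE z in \<pi>. z \<in> range h"
  obtains q where "\<pi> = distr (measure_pmf q) borel h"
    and "\<And>x y. h x = h y \<Longrightarrow> pmf q x = pmf q y"
proof -
  interpret prob_space \<pi> by fact
  define m where "m x = measure \<pi> {h x} / card (h -` {h x})" for x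
  have sing: "{z} \<in> sets \<pi>" for z
    by (simp add: sets)
  \<comment> \<open>Grouping the sum by the value of \<open>h\<close> recovers the mass of each
    atom. The case \<open>A = UNIV\<close> makes \<open>m\<close> a probability weight; general
    \<open>A\<close> identifies its push-forward with \<pi>.\<close>
  have fibre: "(\<Sum>x\<in>h -` A. m x) = measure \<pi> A" if A: "A \<in> sets borel" for A
  proof -
    have "(\<Sum>x\<in>h -` A. m x) = (\<Sum>z\<in>range h \<inter> A. \<Sum>x\<in>{x \<in> h -` A. h x = z}. m x)"
      by (rule sum.group[symmetric]) auto
    also have "\<dots> = (\<Sum>z\<in>range h \<inter> A. measure \<pi> {z})"
    proof (rule sum.cong[OF refl])
      fix z assume z: "z \<in> range h \<inter> A"
      then have eq: "{x \<in> h -` A. h x = z} = h -` {z}" by auto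
      have "card (h -` {z}) \<noteq> 0" using z by auto
      moreover have "(\<Sum>x\<in>h -` {z}. m x) = (\<Sum>x\<in>h -` {z}. measure \<pi> {z} / card (h -` {z}))"
        by (rule sum.cong) (auto simp: m_def)
      ultimately show "(\<Sum>x\<in>{x \<in> h -` A. h x = z}. m x) = measure \<pi> {z}"
        unfolding eq by simp
    qed
    also have "\<dots> = measure \<pi> (range h \<inter> A)"
      by (rule finite_measure_eq_sum_singleton[symmetric]) (auto simp: sing)
    also have "\<dots> = measure \<pi> A"
    proof (rule finite_measure_eq_AE)
      show "AE x in \<pi>. (x \<in> range h \<inter> A) = (x \<in> A)"
        using supp by eventually_elim auto
      have "range h \<in> sets borel"
        by (intro borel_closed finite_imp_closed) simp
      then show "range h \<inter> A \<in> sets \<pi>" using A by (auto simp: sets)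
    qed (simp add: A sets)
    finally show ?thesis .
  qed
  define q where "q = embed_pmf m"
  have pmf_q: "pmf q x = m x" for x
    unfolding q_def
  proof (rule pmf_embed_pmf)
    show "(\<integral>\<^sup>+x. ennreal (m x) \<partial>count_space UNIV) = 1"
      using fibre[of UNIV] prob_space sets_eq_imp_space_eq[OF sets]
      by (simp add: nn_integral_count_space_finite sum_ennreal m_def)
  qed (simp add: m_def)
  have "\<pi> = distr (measure_pmf q) borel h"
  proof (rule measure_eqI)
    fix A assume "A \<in> sets \<pi>"
    then have "A \<in> sets borel" by (simp add: sets)
    then show "emeasure \<pi> A = emeasure (distr (measure_pmf q) borel h) A"
      by (simp add: emeasure_distr_pmf_borel emeasure_measure_pmf_finite_type pmf_q fibre
          emeasure_eq_measure)
  qed (simp add: sets)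
  moreover have "pmf q x = pmf q y" if "h x = h y" for x y
    by (simp add: pmf_q m_def that)
  ultimately show ?thesis using that by blast
qed

text \<open>A push-forward along \<open>a\<close> records only the total mass of each fibre. If the
  weight is constant there, this total is the size of the fibre times the common value, so the
  weight can be read off.\<close>

lemma pmf_eqI_fibre_constant:
  fixes p r :: "'n::finite pmf" and a :: "'n \<Rightarrow> 'a::t1_space"
  assumes eq: "distr (measure_pmf p) borel a = distr (measure_pmf r) borel a"
    and p: "\<And>i j. a i = a j \<Longrightarrow> pmf p i = pmf p j"
    and r: "\<And>i j. a i = a j \<Longrightarrow> pmf r i = pmf r j"
  shows "p = r"
proof (rule pmf_eqI)
  fix i
  let ?A = "a -` {a i}"
  have *: "measure (distr (measure_pmf s) borel a) {a i} = card ?A * pmf s i"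
    if "\<And>i j. a i = a j \<Longrightarrow> pmf s i = pmf s j" for s
  proof -
    have "measure (distr (measure_pmf s) borel a) {a i} = (\<Sum>j\<in>?A. pmf s j)"
      by (simp add: measure_distr measure_measure_pmf_finite)
    also have "\<dots> = (\<Sum>j\<in>?A. pmf s i)"
      by (rule sum.cong) (auto intro: that)
    finally show ?thesis by simp
  qed
  have "card ?A \<noteq> 0" by auto
  then show "pmf p i = pmf r i"
    using *[OF p] *[OF r] eq by simp
qed

lemma coupling_of_index_coupling:
  fixes a b :: "'n::finite \<Rightarrow> 'a::{second_countable_topology,t1_space}"
  assumes q: "q \<in> index_couplings"
  shows "distr (measure_pmf q) borel (\<lambda>(i, j). (a i, b j)) \<in>
    couplings (distr (measure_pmf (pmf_of_set UNIV)) borel a)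
              (distr (measure_pmf (pmf_of_set UNIV)) borel b)"
proof -
  let ?U = "measure_pmf (pmf_of_set (UNIV :: 'n set))"
  let ?\<pi> = "distr (measure_pmf q) borel (\<lambda>(i, j). (a i, b j))"
  have "distr ?\<pi> borel fst = distr (measure_pmf (map_pmf fst q)) borel a"
    by (simp add: map_pmf_rep_eq distr_distr borel_measurable_continuous_onI continuous_on_fst
        o_def case_prod_beta)
  moreover have "distr ?\<pi> borel snd = distr (measure_pmf (map_pmf snd q)) borel b"
    by (simp add: map_pmf_rep_eq distr_distr borel_measurable_continuous_onI continuous_on_snd
        o_def case_prod_beta)
  moreover have "sets (distr ?U borel a \<Otimes>\<^sub>M distr ?U borel b) = sets (borel :: ('a \<times> 'a) measure)"
    unfolding borel_prod[symmetric] by (rule sets_pair_measure_cong) auto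
  \<comment> \<open>\<open>couplings\<close> takes each marginal with the given measure as target
    space; only its sigma-algebra matters, and that is \<open>borel\<close>.\<close>
  moreover have "distr ?\<pi> (distr ?U borel c) f = distr ?\<pi> borel f" for c :: "'n \<Rightarrow> 'a" and f
    by (rule distr_cong) auto
  ultimately show ?thesis
    using q by (simp add: couplings_def index_couplings_def)
qed

text \<open>The mass of an atom of the coupling is spread evenly over the index pairs that are sent
  to it, so that the marginals of the lifted law are uniform although the points may repeat.\<close>

lemma index_coupling_of_coupling:
  fixes a b :: "'n::finite \<Rightarrow> 'a::{second_countable_topology,t1_space}"
  assumes "\<pi> \<in> couplings (distr (measure_pmf (pmf_of_set UNIV)) borel a)
                           (distr (measure_pmf (pmf_of_set UNIV)) borel b)"
  obtains q where "q \<in> index_couplings" "\<pi> = distr (measure_pmf q) borel (\<lambda>(i, j). (a i, b j))"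
proof -
  let ?U = "pmf_of_set (UNIV :: 'n set)"
  let ?h = "\<lambda>(i, j). (a i, b j)"
  have "sets (distr ?U borel a \<Otimes>\<^sub>M distr ?U borel b) = sets (borel :: ('a \<times> 'a) measure)"
    unfolding borel_prod[symmetric] by (rule sets_pair_measure_cong) auto
  then have sets: "sets \<pi> = sets borel"
    using assms by (simp add: couplings_def)
  have fst: "distr \<pi> borel fst = distr ?U borel a"
    using assms distr_cong[of \<pi> \<pi> "distr ?U borel a" borel fst fst]
    by (simp add: couplings_def)
  have snd: "distr \<pi> borel snd = distr ?U borel b"
    using assms distr_cong[of \<pi> \<pi> "distr ?U borel b" borel snd snd]
    by (simp add: couplings_def)
  have meas: "fst \<in> \<pi> \<rightarrow>\<^sub>M borel" "snd \<in> \<pi> \<rightarrow>\<^sub>M borel"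
    by (simp_all add: measurable_cong_sets[OF sets refl] borel_measurable_continuous_onI
        continuous_on_fst continuous_on_snd)
  \<comment> \<open>The definition of \<open>couplings\<close> does not mention total mass; it is
    inherited from the first marginal.\<close>
  have "prob_space (distr \<pi> borel fst)"
    unfolding fst by (rule prob_space.prob_space_distr) (auto intro: measure_pmf.prob_space_axioms)
  then have prob: "prob_space \<pi>"
    using meas(1) by (rule prob_space_distrD[rotated])
  have range: "range c \<in> sets borel" for c :: "'n \<Rightarrow> 'a"
    by (intro borel_closed finite_imp_closed) simp
  have supp_U: "AE x in distr ?U borel c. x \<in> range c" for c :: "'n \<Rightarrow> 'a"
    using range[of c] by (subst AE_distr_iff) auto
  \<comment> \<open>Each marginal lives on a finite range, so \<pi> lives on their product, which is
    \<open>range ?h\<close> because \<open>?h\<close> runs over all index pairs.\<close>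
  have "AE z in \<pi>. fst z \<in> range a"
    using supp_U[of a] range[of a] meas(1) unfolding fst[symmetric]
    by (subst (asm) AE_distr_iff) auto
  moreover have "AE z in \<pi>. snd z \<in> range b"
    using supp_U[of b] range[of b] meas(2) unfolding snd[symmetric]
    by (subst (asm) AE_distr_iff) auto
  ultimately have "AE z in \<pi>. z \<in> range ?h"
    by eventually_elim (auto simp: image_iff prod_eq_iff)
  from pmf_lift_finite_support[OF prob sets this] obtain q where
    q: "\<pi> = distr (measure_pmf q) borel ?h"
    and const: "\<And>x y. ?h x = ?h y \<Longrightarrow> pmf q x = pmf q y"
    by blast
  have pmf_fst: "pmf (map_pmf fst q) i = (\<Sum>j\<in>UNIV. pmf q (i, j))" for i
  proof -
    have "fst -` {i} = Pair i ` (UNIV :: 'n set)" by auto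
    then show ?thesis
      by (simp add: pmf_map measure_measure_pmf_finite sum.reindex inj_on_def)
  qed
  have pmf_snd: "pmf (map_pmf snd q) j = (\<Sum>i\<in>UNIV. pmf q (i, j))" for j
  proof -
    have "snd -` {j} = (\<lambda>i. (i, j)) ` (UNIV :: 'n set)" by auto
    then show ?thesis
      by (simp add: pmf_map measure_measure_pmf_finite sum.reindex inj_on_def)
  qed
  have "map_pmf fst q = ?U"
  proof (rule pmf_eqI_fibre_constant)
    show "distr (map_pmf fst q) borel a = distr ?U borel a"
      unfolding fst[symmetric] q
      by (simp add: map_pmf_rep_eq distr_distr borel_measurable_continuous_onI continuous_on_fst
          o_def case_prod_beta)
    \<comment> \<open>If \<open>a i = a j\<close>, then \<open>?h (i, k) = ?h (j, k)\<close> for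
      every \<open>k\<close>, so rows \<open>i\<close> and \<open>j\<close> of \<open>q\<close>
      agree entry by entry.\<close>
    show "pmf (map_pmf fst q) i = pmf (map_pmf fst q) j" if "a i = a j" for i j
      unfolding pmf_fst by (rule sum.cong) (auto intro!: const simp: that)
  qed simp
  moreover have "map_pmf snd q = ?U"
  proof (rule pmf_eqI_fibre_constant)
    show "distr (map_pmf snd q) borel b = distr ?U borel b"
      unfolding snd[symmetric] q
      by (simp add: map_pmf_rep_eq distr_distr borel_measurable_continuous_onI continuous_on_snd
          o_def case_prod_beta)
    show "pmf (map_pmf snd q) i = pmf (map_pmf snd q) j" if "b i = b j" for i j
      unfolding pmf_snd by (rule sum.cong) (auto intro!: const simp: that)
  qed simp
  ultimately show ?thesis
    using that q by (simp add: index_couplings_def)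
qed

section \<open>Stability of the squared Wasserstein distance under changes of cost\<close>

lemma wasserstein2_eq_index_couplings:
  fixes a b :: "'n::finite \<Rightarrow> 'a::{second_countable_topology,metric_space}"
  shows "(wasserstein2 (distr (measure_pmf (pmf_of_set UNIV)) borel a)
                       (distr (measure_pmf (pmf_of_set UNIV)) borel b))\<^sup>2 =
    enn2real (INF q\<in>index_couplings. \<integral>\<^sup>+z. ennreal ((dist (a (fst z)) (b (snd z)))\<^sup>2) \<partial>measure_pmf q)"
proof -
  let ?C = "couplings (distr (measure_pmf (pmf_of_set UNIV)) borel a)
                      (distr (measure_pmf (pmf_of_set UNIV)) borel b)"
  have C: "?C = (\<lambda>q. distr (measure_pmf q) borel (\<lambda>(i, j). (a i, b j))) ` index_couplings"
    using coupling_of_index_coupling[of _ a b] index_coupling_of_coupling[of _ a b] by blast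
  have "(\<integral>\<^sup>+z. ennreal ((dist (fst z) (snd z))\<^sup>2) \<partial>distr (measure_pmf q) borel (\<lambda>(i, j). (a i, b j)))
    = (\<integral>\<^sup>+z. ennreal ((dist (a (fst z)) (b (snd z)))\<^sup>2) \<partial>measure_pmf q)" for q
    by (subst nn_integral_distr)
      (auto simp: case_prod_beta intro!: measurable_compose[OF _ measurable_ennreal]
        borel_measurable_continuous_onI continuous_intros)
  then show ?thesis
    by (simp add: wasserstein2_def C image_image)
qed

lemma pair_pmf_index_coupling: "pair_pmf (pmf_of_set UNIV) (pmf_of_set UNIV) \<in> index_couplings"
  by (simp add: index_couplings_def map_fst_pair_pmf map_snd_pair_pmf)

text \<open>Integrating against a probability weight adds exactly \<open>e\<close> to the cost of
  every index coupling, and the infimum over the common set of couplings preserves this.\<close>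

lemma wasserstein2_power2_mono_cost:
  fixes a b a' b' :: "'n::finite \<Rightarrow> 'a::{second_countable_topology,metric_space}"
  assumes le: "\<And>i j. (dist (a i) (b j))\<^sup>2 \<le> (dist (a' i) (b' j))\<^sup>2 + e" and e: "0 \<le> e"
  shows "(wasserstein2 (distr (measure_pmf (pmf_of_set UNIV)) borel a)
                       (distr (measure_pmf (pmf_of_set UNIV)) borel b))\<^sup>2
    \<le> (wasserstein2 (distr (measure_pmf (pmf_of_set UNIV)) borel a')
                    (distr (measure_pmf (pmf_of_set UNIV)) borel b'))\<^sup>2 + e"
proof -
  define cost where
    "cost a b q = (\<integral>\<^sup>+z. ennreal ((dist (a (fst z)) (b (snd z)))\<^sup>2) \<partial>measure_pmf q)"
    for a b :: "'n \<Rightarrow> 'a" and q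
  have cost_le: "cost a b q \<le> cost a' b' q + ennreal e" for q
  proof -
    have "cost a b q \<le>
      (\<integral>\<^sup>+z. ennreal ((dist (a' (fst z)) (b' (snd z)))\<^sup>2) + ennreal e \<partial>measure_pmf q)"
      unfolding cost_def by (intro nn_integral_mono) (simp add: le e flip: ennreal_plus)
    also have "\<dots> = cost a' b' q + ennreal e"
      by (simp add: cost_def nn_integral_add)
    finally show ?thesis .
  qed
  let ?I = "\<lambda>a b. INF q\<in>index_couplings. cost a b q"
  \<comment> \<open>Truncated subtraction moves \<open>e\<close> to the left, so that the right side
    is a bare cost and the infimum can be taken over it.\<close>
  have "?I a b - ennreal e \<le> cost a' b' q" if "q \<in> index_couplings" for q
    using INF_lower2[OF that cost_le] by (simp add: ennreal_minus_le_iff add.commute)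
  then have "?I a b - ennreal e \<le> ?I a' b'"
    by (rule INF_greatest)
  then have I_le: "?I a b \<le> ?I a' b' + ennreal e"
    by (simp add: ennreal_minus_le_iff add.commute)
  \<comment> \<open>The independent coupling has finite cost. Finiteness matters because
    \<open>enn2real\<close> sends \<open>top\<close> to 0, so it is monotone and additive only below
    \<open>top\<close>.\<close>
  have "?I a' b' \<le> cost a' b' (pair_pmf (pmf_of_set UNIV) (pmf_of_set UNIV))"
    by (rule INF_lower) (rule pair_pmf_index_coupling)
  also have "\<dots> < top"
    unfolding cost_def by (subst nn_integral_measure_pmf_finite)
      (auto simp: ennreal_mult_less_top)
  finally have fin: "?I a' b' < top" .
  have "enn2real (?I a b) \<le> enn2real (?I a' b' + ennreal e)"
    using I_le fin by (intro enn2real_mono) auto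
  also have "\<dots> = enn2real (?I a' b') + e"
    using fin e by (simp add: enn2real_plus)
  finally show ?thesis
    unfolding wasserstein2_eq_index_couplings cost_def .
qed

lemma wasserstein2_power2_cost_lipschitz:
  fixes a b a' b' :: "'n::finite \<Rightarrow> 'a::{second_countable_topology,metric_space}"
  assumes "\<And>i j. \<bar>(dist (a i) (b j))\<^sup>2 - (dist (a' i) (b' j))\<^sup>2\<bar> \<le> e"
  shows "\<bar>(wasserstein2 (distr (measure_pmf (pmf_of_set UNIV)) borel a)
                        (distr (measure_pmf (pmf_of_set UNIV)) borel b))\<^sup>2
    - (wasserstein2 (distr (measure_pmf (pmf_of_set UNIV)) borel a')
                    (distr (measure_pmf (pmf_of_set UNIV)) borel b'))\<^sup>2\<bar> \<le> e"
proof -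
  have "0 \<le> e"
    using assms order_trans[OF abs_ge_zero] by blast
  moreover have "(dist (a i) (b j))\<^sup>2 \<le> (dist (a' i) (b' j))\<^sup>2 + e"
    "(dist (a' i) (b' j))\<^sup>2 \<le> (dist (a i) (b j))\<^sup>2 + e" for i j
    using assms[of i j] by auto
  ultimately show ?thesis
    using wasserstein2_power2_mono_cost[of a b a' b' e]
      wasserstein2_power2_mono_cost[of a' b' a b e] by (simp add: abs_le_iff)
qed

section \<open>Regularity of a single slice in the points and in the direction\<close>

text \<open>The empirical measure is the law of a row picked at a uniformly random index; repeated
  rows collect their multiplicity.\<close>

lemma empirical_eq_distr:
  fixes Y :: "real^'d^'n"
  shows "empirical Y = distr (measure_pmf (pmf_of_set UNIV)) borel (\<lambda>k. Y $ k)"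
proof (rule measure_eqI)
  fix A assume "A \<in> sets (empirical Y)"
  then have A: "A \<in> sets borel" by simp
  have "(\<Sum>k\<in>UNIV. indicator A (Y $ k) :: ennreal) = ennreal (card ((\<lambda>k. Y $ k) -` A))"
    by (simp add: indicator_def sum.If_cases vimage_def ennreal_of_nat_eq_real_of_nat)
  then show "emeasure (empirical Y) A =
      emeasure (distr (measure_pmf (pmf_of_set UNIV)) borel (\<lambda>k. Y $ k)) A"
    using A by (simp add: emeasure_empirical emeasure_distr_pmf_borel emeasure_pmf_of_set
        flip: ennreal_mult)
qed simp

lemma distr_empirical_inner:
  fixes Y :: "real^'d^'n"
  shows "distr (empirical Y) borel (\<lambda>x. \<theta> \<bullet> x) =
    distr (measure_pmf (pmf_of_set UNIV)) borel (\<lambda>k. \<theta> \<bullet> Y $ k)"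
  unfolding empirical_eq_distr by (subst distr_distr) (auto simp: o_def)

text \<open>Direction and points may change together, so one estimate serves both the Lipschitz
  bound in \<open>Y\<close> and the continuity in \<theta>.\<close>

lemma sw_slice_diff_le:
  fixes Y Y' Z :: "real^'d^'n"
  assumes "\<And>i j. \<bar>(\<theta> \<bullet> (Y $ i - Z $ j))\<^sup>2 - (\<theta>' \<bullet> (Y' $ i - Z $ j))\<^sup>2\<bar> \<le> e"
  shows "\<bar>sw_slice Z \<theta> Y - sw_slice Z \<theta>' Y'\<bar> \<le> e"
  unfolding sw_slice_def distr_empirical_inner
  by (rule wasserstein2_power2_cost_lipschitz)
    (use assms in \<open>simp add: dist_real_def inner_diff_right\<close>)

text \<open>The difference of squared costs factors. On the unit ball around \<open>X\<close> the
  sum factor is at most \<open>2 * (norm X + 1 + norm Z)\<close>, and the difference factor is at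
  most \<open>dist Y Y'\<close>. The constant is free of \<theta>, so it survives averaging over
  directions.\<close>

lemma sw_slice_lipschitz:
  fixes X Y Y' Z :: "real^'d^'n"
  assumes \<theta>: "norm \<theta> \<le> 1" and Y: "Y \<in> ball X 1" "Y' \<in> ball X 1"
  shows "\<bar>sw_slice Z \<theta> Y - sw_slice Z \<theta> Y'\<bar> \<le> 2 * (norm X + 1 + norm Z) * dist Y Y'"
proof (rule sw_slice_diff_le)
  fix i j
  have inner: "\<bar>\<theta> \<bullet> v\<bar> \<le> norm v" for v
    using Cauchy_Schwarz_ineq2[of \<theta> v] mult_right_mono[OF \<theta>, of "norm v"] by simp
  have "norm Y \<le> norm X + 1" "norm Y' \<le> norm X + 1"
    using Y norm_triangle_ineq4[of X "X - Y"] norm_triangle_ineq4[of X "X - Y'"]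
    by (auto simp: dist_norm)
  then have "norm (Y $ i) \<le> norm X + 1" "norm (Y' $ i) \<le> norm X + 1" "norm (Z $ j) \<le> norm Z"
    using Finite_Cartesian_Product.norm_nth_le[of Y i] Finite_Cartesian_Product.norm_nth_le[of Y' i]
      Finite_Cartesian_Product.norm_nth_le[of Z j] by auto
  then have sum: "norm ((Y $ i - Z $ j) + (Y' $ i - Z $ j)) \<le> 2 * (norm X + 1 + norm Z)"
    using norm_triangle_ineq[of "Y $ i - Z $ j" "Y' $ i - Z $ j"]
      norm_triangle_ineq4[of "Y $ i" "Z $ j"] norm_triangle_ineq4[of "Y' $ i" "Z $ j"]
    by (simp only: distrib_left)
  have diff: "norm (Y $ i - Y' $ i) \<le> dist Y Y'"
    using Finite_Cartesian_Product.norm_nth_le[of "Y - Y'" i] by (simp add: dist_norm)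
  have "(\<theta> \<bullet> (Y $ i - Z $ j))\<^sup>2 - (\<theta> \<bullet> (Y' $ i - Z $ j))\<^sup>2 =
      (\<theta> \<bullet> ((Y $ i - Z $ j) + (Y' $ i - Z $ j))) * (\<theta> \<bullet> (Y $ i - Y' $ i))"
    by (simp only: power2_eq_square inner_add_right inner_diff_right) (simp add: field_simps)
  then have "\<bar>(\<theta> \<bullet> (Y $ i - Z $ j))\<^sup>2 - (\<theta> \<bullet> (Y' $ i - Z $ j))\<^sup>2\<bar> =
      \<bar>\<theta> \<bullet> ((Y $ i - Z $ j) + (Y' $ i - Z $ j))\<bar> * \<bar>\<theta> \<bullet> (Y $ i - Y' $ i)\<bar>"
    by (simp only: abs_mult)
  also have "\<dots> \<le> 2 * (norm X + 1 + norm Z) * dist Y Y'"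
    by (intro mult_mono order_trans[OF inner] sum diff) auto
  finally show "\<bar>(\<theta> \<bullet> (Y $ i - Z $ j))\<^sup>2 - (\<theta> \<bullet> (Y' $ i - Z $ j))\<^sup>2\<bar>
      \<le> 2 * (norm X + 1 + norm Z) * dist Y Y'" .
qed

text \<open>The same factorisation, now in the direction: the bound \<open>?B\<close> contains
  \<open>norm (\<theta>' - \<theta>)\<close> and hence tends to 0.\<close>

lemma continuous_on_sw_slice_direction:
  fixes Y Z :: "real^'d^'n"
  shows "continuous_on UNIV (\<lambda>\<theta>. sw_slice Z \<theta> Y)"
proof (rule continuous_at_imp_continuous_on, rule ballI)
  fix \<theta> :: "real^'d"
  let ?B = "\<lambda>\<theta>'. norm (\<theta>' + \<theta>) * norm (\<theta>' - \<theta>) * (norm Y + norm Z)\<^sup>2"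
  have bound: "\<bar>sw_slice Z \<theta>' Y - sw_slice Z \<theta> Y\<bar> \<le> ?B \<theta>'" for \<theta>'
  proof (rule sw_slice_diff_le)
    fix i j
    let ?v = "Y $ i - Z $ j"
    have v: "norm ?v \<le> norm Y + norm Z"
      using norm_triangle_ineq4[of "Y $ i" "Z $ j"] Finite_Cartesian_Product.norm_nth_le[of Y i]
        Finite_Cartesian_Product.norm_nth_le[of Z j]
      by linarith
    have "(\<theta>' \<bullet> ?v)\<^sup>2 - (\<theta> \<bullet> ?v)\<^sup>2 = ((\<theta>' + \<theta>) \<bullet> ?v) * ((\<theta>' - \<theta>) \<bullet> ?v)"
      by (simp add: power2_eq_square algebra_simps)
    then have "\<bar>(\<theta>' \<bullet> ?v)\<^sup>2 - (\<theta> \<bullet> ?v)\<^sup>2\<bar> = \<bar>(\<theta>' + \<theta>) \<bullet> ?v\<bar> * \<bar>(\<theta>' - \<theta>) \<bullet> ?v\<bar>"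
      by (simp only: abs_mult)
    also have "\<dots> \<le> (norm (\<theta>' + \<theta>) * norm ?v) * (norm (\<theta>' - \<theta>) * norm ?v)"
      by (intro mult_mono Cauchy_Schwarz_ineq2) auto
    also have "\<dots> = norm (\<theta>' + \<theta>) * norm (\<theta>' - \<theta>) * (norm ?v)\<^sup>2"
      by (simp add: power2_eq_square)
    also have "\<dots> \<le> ?B \<theta>'"
      by (intro mult_left_mono power_mono v) auto
    finally show "\<bar>(\<theta>' \<bullet> ?v)\<^sup>2 - (\<theta> \<bullet> ?v)\<^sup>2\<bar> \<le> ?B \<theta>'" .
  qed
  have "(?B \<longlongrightarrow> ?B \<theta>) (at \<theta>)"
    by (intro tendsto_intros)
  then have "(?B \<longlongrightarrow> 0) (at \<theta>)" by simp
  then have "((\<lambda>\<theta>'. sw_slice Z \<theta>' Y - sw_slice Z \<theta> Y) \<longlongrightarrow> 0) (at \<theta>)"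
    by (rule Lim_null_comparison[rotated]) (simp add: bound)
  then show "isCont (\<lambda>\<theta>. sw_slice Z \<theta> Y) \<theta>"
    unfolding isCont_def by (simp add: LIM_zero_iff)
qed

section \<open>Averaging over directions\<close>

text \<open>A continuous function is bounded on the compact sphere, and the measure is finite.
  Integrability allows the difference of two energies to be written as one integral.\<close>

lemma set_integrable_sw_slice:
  fixes Y Z :: "real^'d^'n"
  shows "set_integrable sphere_unif (sphere 0 1) (\<lambda>\<theta>. sw_slice Z \<theta> Y)"
proof -
  interpret prob_space "sphere_unif :: (real^'d) measure"
    by (rule prob_space_sphere_unif)
  have "compact ((\<lambda>\<theta>. sw_slice Z \<theta> Y) ` sphere 0 1)"
    by (intro compact_continuous_image continuous_on_subset[OF continuous_on_sw_slice_direction])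
      auto
  then have "bounded ((\<lambda>\<theta>. sw_slice Z \<theta> Y) ` sphere 0 1)"
    by (rule compact_imp_bounded)
  then obtain B where B: "B > 0" "\<And>\<theta>. \<theta> \<in> sphere 0 1 \<Longrightarrow> norm (sw_slice Z \<theta> Y) \<le> B"
    unfolding bounded_pos by blast
  have [measurable]: "(\<lambda>\<theta>. sw_slice Z \<theta> Y) \<in> borel_measurable borel"
    by (rule borel_measurable_continuous_onI) (rule continuous_on_sw_slice_direction)
  have "indicator (sphere 0 1) \<in> borel_measurable (borel :: (real^'d) measure)"
    by (intro borel_measurable_indicator) auto
  then have "(\<lambda>\<theta>. indicator (sphere 0 1) \<theta> *\<^sub>R sw_slice Z \<theta> Y) \<in> borel_measurable sphere_unif"
    by measurable
  then show ?thesis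
    unfolding set_integrable_def
    by (intro integrable_const_bound[where B = B])
      (use B in \<open>auto simp: indicator_def intro!: AE_I2\<close>)
qed

lemma sw_energy_lipschitz:
  fixes X Y Y' Z :: "real^'d^'n"
  assumes Y: "Y \<in> ball X 1" "Y' \<in> ball X 1"
  shows "\<bar>sw_energy Z Y - sw_energy Z Y'\<bar> \<le> 2 * (norm X + 1 + norm Z) * dist Y Y'"
proof -
  interpret prob_space "sphere_unif :: (real^'d) measure"
    by (rule prob_space_sphere_unif)
  let ?L = "2 * (norm X + 1 + norm Z) * dist Y Y'"
  let ?f = "\<lambda>\<theta>. indicator (sphere 0 1) \<theta> *\<^sub>R (sw_slice Z \<theta> Y - sw_slice Z \<theta> Y')"
  have int: "integrable sphere_unif ?f"
    using set_integral_diff(1)[OF set_integrable_sw_slice set_integrable_sw_slice]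
    by (simp add: set_integrable_def)
  have "sw_energy Z Y - sw_energy Z Y' = (LINT \<theta>|sphere_unif. ?f \<theta>)"
    using set_integral_diff(2)[OF set_integrable_sw_slice set_integrable_sw_slice, of Z Y Z Y']
    by (simp add: sw_energy_def set_lebesgue_integral_def)
  also have "\<bar>\<dots>\<bar> \<le> (LINT \<theta>|sphere_unif. \<bar>?f \<theta>\<bar>)"
    using integral_norm_bound[of sphere_unif ?f] by simp
  also have "\<dots> \<le> ?L"
  proof (rule integral_le_const)
    \<comment> \<open>Off the sphere the indicator makes the integrand 0 and \<open>?L\<close> is
      nonnegative, so the bound holds at every \<theta>.\<close>
    show "AE \<theta> in sphere_unif. \<bar>?f \<theta>\<bar> \<le> ?L"
      using sw_slice_lipschitz[OF _ Y, of _ Z] by (intro AE_I2) (simp add: indicator_def)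
  qed (use int in simp)
  finally show ?thesis .
qed

lemma sw_energy_mc_lipschitz:
  fixes X Y Y' Z :: "real^'d^'n"
  assumes \<theta>: "\<And>i. i \<in> {1..p} \<Longrightarrow> \<theta> i \<in> sphere 0 1" and Y: "Y \<in> ball X 1" "Y' \<in> ball X 1"
  shows "\<bar>sw_energy_mc Z p \<theta> Y - sw_energy_mc Z p \<theta> Y'\<bar> \<le> 2 * (norm X + 1 + norm Z) * dist Y Y'"
proof -
  let ?L = "2 * (norm X + 1 + norm Z) * dist Y Y'"
  have "\<bar>sw_energy_mc Z p \<theta> Y - sw_energy_mc Z p \<theta> Y'\<bar> =
      1 / real p * \<bar>\<Sum>i = 1..p. sw_slice Z (\<theta> i) Y - sw_slice Z (\<theta> i) Y'\<bar>"
    by (simp add: sw_energy_mc_def sum_subtractf flip: diff_divide_distrib)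
  also have "\<dots> \<le> 1 / real p * (\<Sum>i = 1..p. \<bar>sw_slice Z (\<theta> i) Y - sw_slice Z (\<theta> i) Y'\<bar>)"
    by (intro mult_left_mono sum_abs) auto
  also have "\<dots> \<le> 1 / real p * (\<Sum>i = 1..p. ?L)"
    using \<theta> by (intro mult_left_mono sum_mono sw_slice_lipschitz Y) auto
  \<comment> \<open>An equality for positive \<open>p\<close>; at \<open>p = 0\<close> the left side
    is 0 by the convention for division.\<close>
  also have "\<dots> \<le> ?L"
    by simp
  finally show ?thesis .
qed

text \<open>The slice bounds hold on every unit ball, so the radius can stay fixed while the
  constant \<open>L X\<close> varies with the centre.\<close>

lemma locally_lipschitzI_unit_ball:
  fixes f :: "'a::metric_space \<Rightarrow> real"
  assumes "\<And>X. 0 \<le> L X"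
    and "\<And>X Y Y'. Y \<in> ball X 1 \<Longrightarrow> Y' \<in> ball X 1 \<Longrightarrow> \<bar>f Y - f Y'\<bar> \<le> L X * dist Y Y'"
  shows "locally_lipschitz f"
  unfolding locally_lipschitz_def
proof
  fix X
  have "(L X)-lipschitz_on (ball X 1) f"
    by (rule lipschitz_onI) (use assms in \<open>auto simp: dist_real_def\<close>)
  then show "\<exists>U L. open U \<and> X \<in> U \<and> L-lipschitz_on U f"
    by (intro exI[of _ "ball X 1"] exI[of _ "L X"]) auto
qed

theorem theorem2p1:
  fixes Z :: "real^'d^'n"
  shows "locally_lipschitz (sw_energy Z) \<and>
    (\<forall>p\<ge>1. \<forall>\<theta> :: nat \<Rightarrow> real^'d. (\<forall>i\<in>{1..p}. \<theta> i \<in> sphere 0 1) \<longrightarrow>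
       locally_lipschitz (sw_energy_mc Z p \<theta>))"
proof (intro conjI allI impI)
  show "locally_lipschitz (sw_energy Z)"
    by (rule locally_lipschitzI_unit_ball[where L = "\<lambda>X. 2 * (norm X + 1 + norm Z)"])
      (simp, rule sw_energy_lipschitz)
next
  fix p and \<theta> :: "nat \<Rightarrow> real^'d"
  assume "\<forall>i\<in>{1..p}. \<theta> i \<in> sphere 0 1"
  then show "locally_lipschitz (sw_energy_mc Z p \<theta>)"
    by (intro locally_lipschitzI_unit_ball[where L = "\<lambda>X. 2 * (norm X + 1 + norm Z)"]
        sw_energy_mc_lipschitz) auto
qed

end
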